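(* For $j\in[p]=\{1,\dots,p\}$ let $h^j=f^j+g^j$ with $f^j:\mathbb{R}^n\to\mathbb{R}^m$ continuously differentiable and $g^j:\mathbb{R}^n\to\mathbb{R}^m\cup\{+\infty_C\}$ proper, closed and $C$-convex, and let $H(x)=\{h^1(x),\dots,h^p(x)\}$. Let $x^0\in\mathrm{dom}(H)$ and assume that $H$ satisfies the following: with $\mathcal{L}:=\{x\in\mathbb{R}^n: H(x)\preceq^\ell H(x^0)\}$, for every sequence of sets $\{S_k\}_{k\ge0}$ with each $S_k\in\{H(x):x\in\mathcal{L}\}$ and $S_{k+1}\preceq^\ell S_k$ for all $k$, there exists a bounded set $S\subseteq\mathbb{R}^m$ with $S\preceq^\ell S_k$ for all $k\in\mathbb{N}\cup\{0\}$. Suppose that $\nabla f^j$ is Lipschitz continuous with constant $L^j$ for every $j\in[p]$ and let $L:=\max\{L^j:j\in[p]\}$. Let $\{x^k\}$ be an infinite sequence of non-stationary points in $\mathrm{dom}(H)$ of the problem $\preceq^\ell$-$\min_{x\in\mathbb{R}^n} H(x)$, generated from $x^0$ by the proximal gradient method without line search with parameter $l>L/2$, $l>0$ (defined in the context), with associated directions $v^k_l$. Then $\lim_{k\to+\infty}\|v^k_l\|=0$.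
   Context: $C\subset\mathbb{R}^m$ is a closed, convex, pointed cone with nonempty interior; $w\preceq_C w'$ iff $w'-w\in C$, $w\prec_C w'$ iff $w'-w\in\mathrm{int}(C)$. The extra element $+\infty_C$ satisfies $w\prec_C+\infty_C$ for all $w\in\mathbb{R}^m$. For sets, $U\preceq^\ell V$ iff $V\subseteq U+C$, i.e. for every $v\in V$ there is $u\in U$ with $u\preceq_C v$. $\mathrm{dom}(H):=\{x:h^j(x)\prec_C+\infty_C\ \forall j\in[p]\}$. $C^*=\{z:w^\top z\ge0\ \forall w\in C\}$, $\mathcal{Z}:=\{z\in C^*:\|z\|=1\}$, $\phi(w):=\sup_{z\in\mathcal{Z}}z^\top w$, with $z^\top(+\infty_C):=+\infty$ for $z\in C^*\setminus\{0\}$ and $\phi(+\infty_C):=+\infty$. $\nabla f^j(x)\in\mathbb{R}^{n\times m}$ is the transposed Jacobian; norms are Euclidean on vectors and the induced operator norm on matrices. A function $g:\mathbb{R}^n\to\mathbb{R}^m\cup\{+\infty_C\}$ is $C$-convex if $g(\lambda x+(1-\lambda)y)\preceq_C\lambda g(x)+(1-\lambda)g(y)$ for all $x,y$ and $\lambda\in(0,1]$; proper if not identically $+\infty_C$; closed if $x\mapsto z^\top g(x)$ is lower semicontinuous for every $z\in C^*\setminus\{0\}$. Minimal set: $\mathcal{M}(U,C):=\{u\in U:\nexists\,u'\in U,\ u'\ne u,\ u'\preceq_C u\}$; $\omega(x):=|\mathcal{M}(H(x),C)|$, $[\omega(x)]=\{1,\dots,\omega(x)\}$. Partition set: enumerate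 $\mathcal{M}(H(x),C)=\{u_1^x,\dots,u_{\omega(x)}^x\}$ and, with $I_u(x):=\{j\in[p]:h^j(x)=u\}$, put $P_x:=\prod_{j=1}^{\omega(x)}I_{u_j^x}(x)$; elements are written $a=(a_1,\dots,a_{\omega(x)})$. Directional derivative: $D_vh(y):=\lim_{\alpha\to0^+}\frac1\alpha(h(y+\alpha v)-h(y))$ in the extended sense: $D_vh(y)\in-\mathrm{int}(C)$ means $\lim_{\alpha\to0^+}\frac1\alpha z^\top(h(y+\alpha v)-h(y))<0$ in $[-\infty,+\infty]$ for all $z\in C^*\setminus\{0\}$. A point $y\in\mathrm{dom}(H)$ is stationary if for every $a\in P_y$ and every $v\in\mathbb{R}^n$ there is $j\in[\omega(y)]$ with $D_vh^{a_j}(y)\notin-\mathrm{int}(C)$; otherwise non-stationary. Proximal gradient method without line search (stopping test disregarded): at iterate $x^k$ choose $$(a^l_k,v^k_l)\in\operatorname*{arg\,min}_{(a,v)\in P_{x^k}\times\mathbb{R}^n}\left\{\max_{j\in[\omega(x^k)]}\phi\left(\nabla f^{a_j}(x^k)^\top v+g^{a_j}(x^k+v)-g^{a_j}(x^k)\right)+\frac l2\|v\|^2\right\}$$ (the minimum is attained) and set $x^{k+1}:=x^k+v^k_l$. *)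

theory Defs
  imports "HOL-Analysis.Analysis"
begin

text \<open>\<open>'a\<close> with one extra element \<open>PInf\<close>, the greatest element \<open>+\<infinity>\<^sub>C\<close> of the cone order.\<close>

datatype 'a cext = Fin 'a | PInf

fun ext_add :: "'a::plus cext \<Rightarrow> 'a cext \<Rightarrow> 'a cext" where
  "ext_add (Fin u) (Fin w) = Fin (u + w)"
| "ext_add (Fin u) PInf = PInf"
| "ext_add PInf w = PInf"

text \<open>Only differences with a finite subtrahend are meaningful; the last equation is a dummy value.\<close>

fun ext_diff :: "'a::minus cext \<Rightarrow> 'a cext \<Rightarrow> 'a cext" where
  "ext_diff (Fin u) (Fin w) = Fin (u - w)"
| "ext_diff PInf (Fin w) = PInf"
| "ext_diff u PInf = PInf"

text \<open>Used for factors \<open>t \<ge> 0\<close> only. The value of \<open>0 \<cdot> (+\<infinity>\<^sub>C)\<close> is immaterial below: in the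
  convexity inequality it occurs only for \<open>\<lambda> = 1\<close>, where the inequality is trivial under the
  convention \<open>0 \<cdot> (+\<infinity>\<^sub>C) = 0\<close> as well.\<close>

fun ext_scale :: "real \<Rightarrow> 'a::real_vector cext \<Rightarrow> 'a cext" where
  "ext_scale t (Fin u) = Fin (t *\<^sub>R u)"
| "ext_scale t PInf = PInf"

definition pointed :: "'a::real_vector set \<Rightarrow> bool" where
  "pointed C \<longleftrightarrow> C \<inter> uminus ` C = {0}"

fun cone_le :: "'a::real_normed_vector set \<Rightarrow> 'a cext \<Rightarrow> 'a cext \<Rightarrow> bool" where
  "cone_le C (Fin u) (Fin w) \<longleftrightarrow> w - u \<in> C"
| "cone_le C PInf (Fin w) \<longleftrightarrow> False"
| "cone_le C u PInf \<longleftrightarrow> True"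

fun cone_less :: "'a::real_normed_vector set \<Rightarrow> 'a cext \<Rightarrow> 'a cext \<Rightarrow> bool" where
  "cone_less C (Fin u) (Fin w) \<longleftrightarrow> w - u \<in> interior C"
| "cone_less C (Fin u) PInf \<longleftrightarrow> True"
| "cone_less C PInf w \<longleftrightarrow> False"

definition set_le :: "'a::real_normed_vector set \<Rightarrow> 'a cext set \<Rightarrow> 'a cext set \<Rightarrow> bool" where
  "set_le C U V \<longleftrightarrow> (\<forall>v\<in>V. \<exists>u\<in>U. cone_le C u v)"

definition minimal_set :: "'a::real_normed_vector set \<Rightarrow> 'a cext set \<Rightarrow> 'a cext set" where
  "minimal_set C U = {u \<in> U. \<not> (\<exists>u'\<in>U. u' \<noteq> u \<and> cone_le C u' u)}"

definition dual_cone :: "'a::real_inner set \<Rightarrow> 'a set" where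
  "dual_cone C = {z. \<forall>w\<in>C. w \<bullet> z \<ge> 0}"

text \<open>\<open>z\<^sup>T w\<close> in \<open>[-\<infinity>,+\<infinity>]\<close>; meaningful at \<open>w = +\<infinity>\<^sub>C\<close> only for \<open>z \<in> dual_cone C - {0}\<close>.\<close>

fun ext_inner :: "'a::real_inner \<Rightarrow> 'a cext \<Rightarrow> ereal" where
  "ext_inner z (Fin w) = ereal (z \<bullet> w)"
| "ext_inner z PInf = \<infinity>"

fun phi :: "'a::real_inner set \<Rightarrow> 'a cext \<Rightarrow> ereal" where
  "phi C (Fin w) = (SUP z\<in>{z \<in> dual_cone C. norm z = 1}. ereal (z \<bullet> w))"
| "phi C PInf = \<infinity>"

definition cone_convex ::
  "'b::real_normed_vector set \<Rightarrow> ('a::real_vector \<Rightarrow> 'b cext) \<Rightarrow> bool" where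
  "cone_convex C g \<longleftrightarrow> (\<forall>x y. \<forall>t\<in>{0<..1}.
     cone_le C (g (t *\<^sub>R x + (1 - t) *\<^sub>R y))
               (ext_add (ext_scale t (g x)) (ext_scale (1 - t) (g y))))"

definition proper_fun :: "('a \<Rightarrow> 'b cext) \<Rightarrow> bool" where
  "proper_fun g \<longleftrightarrow> (\<exists>x. g x \<noteq> PInf)"

definition lsc :: "('a::topological_space \<Rightarrow> ereal) \<Rightarrow> bool" where
  "lsc q \<longleftrightarrow> (\<forall>x. q x \<le> Liminf (at x) q)"

definition closed_fun ::
  "'b::real_inner set \<Rightarrow> ('a::topological_space \<Rightarrow> 'b cext) \<Rightarrow> bool" where
  "closed_fun C g \<longleftrightarrow> (\<forall>z\<in>dual_cone C - {0}. lsc (\<lambda>x. ext_inner z (g x)))"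

text \<open>The transposed Jacobian, an \<open>n \<times> m\<close> matrix.\<close>

definition grad :: "(real^'n \<Rightarrow> real^'m) \<Rightarrow> real^'n \<Rightarrow> real^'m^'n" where
  "grad f x = transpose (jacobian f (at x))"

definition cont_diff :: "(real^'n \<Rightarrow> real^'m) \<Rightarrow> bool" where
  "cont_diff f \<longleftrightarrow> (\<forall>x. f differentiable (at x)) \<and> continuous_on UNIV (grad f)"

text \<open>The library norm on matrices is the Frobenius norm, hence the explicit operator norm
  instead of \<^term>\<open>lipschitz_on\<close>.\<close>

definition lipschitz_grad :: "real \<Rightarrow> (real^'n \<Rightarrow> real^'m) \<Rightarrow> bool" where
  "lipschitz_grad L f \<longleftrightarrow>
     (\<forall>x y. onorm (\<lambda>w. (grad f x - grad f y) *v w) \<le> L * norm (x - y))"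

text \<open>\<open>D\<^sub>v h(y) \<in> -int(C)\<close> in the extended sense, for \<open>h y\<close> finite.\<close>

definition dir_deriv_in_neg_int ::
  "'b::real_inner set \<Rightarrow> ('a::real_vector \<Rightarrow> 'b cext) \<Rightarrow> 'a \<Rightarrow> 'a \<Rightarrow> bool" where
  "dir_deriv_in_neg_int C h y v \<longleftrightarrow> (\<forall>z\<in>dual_cone C - {0}. \<exists>d::ereal. d < 0 \<and>
     ((\<lambda>\<alpha>::real. ereal (1 / \<alpha>) * ext_inner z (ext_diff (h (y + \<alpha> *\<^sub>R v)) (h y)))
        \<longlongrightarrow> d) (at_right 0))"

definition set_map :: "nat \<Rightarrow> (nat \<Rightarrow> 'a \<Rightarrow> 'b cext) \<Rightarrow> 'a \<Rightarrow> 'b cext set" where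
  "set_map p h x = {h j x | j. j \<in> {1..p}}"

definition domain_of ::
  "'b::real_normed_vector set \<Rightarrow> nat \<Rightarrow> (nat \<Rightarrow> 'a \<Rightarrow> 'b cext) \<Rightarrow> 'a set" where
  "domain_of C p h = {x. \<forall>j\<in>{1..p}. cone_less C (h j x) PInf}"

definition level_set ::
  "'b::real_normed_vector set \<Rightarrow> nat \<Rightarrow> (nat \<Rightarrow> 'a \<Rightarrow> 'b cext) \<Rightarrow> 'a \<Rightarrow> 'a set" where
  "level_set C p h x0 = {x. set_le C (set_map p h x) (set_map p h x0)}"

definition chains_bounded ::
  "'b::real_normed_vector set \<Rightarrow> nat \<Rightarrow> (nat \<Rightarrow> 'a \<Rightarrow> 'b cext) \<Rightarrow> 'a \<Rightarrow> bool" where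
  "chains_bounded C p h x0 \<longleftrightarrow>
     (\<forall>S :: nat \<Rightarrow> 'b cext set.
        (\<forall>k. S k \<in> {set_map p h x | x. x \<in> level_set C p h x0}) \<and>
        (\<forall>k. set_le C (S (Suc k)) (S k))
        \<longrightarrow> (\<exists>B :: 'b set. bounded B \<and> (\<forall>k. set_le C (Fin ` B) (S k))))"

definition omega ::
  "'b::real_normed_vector set \<Rightarrow> nat \<Rightarrow> (nat \<Rightarrow> 'a \<Rightarrow> 'b cext) \<Rightarrow> 'a \<Rightarrow> nat" where
  "omega C p h x = card (minimal_set C (set_map p h x))"

text \<open>\<open>u x 1, \<dots>, u x (\<omega>(x))\<close> lists the minimal elements of \<open>H x\<close> without repetition.\<close>

definition enumerates_minimal ::
  "'b::real_normed_vector set \<Rightarrow> nat \<Rightarrow> (nat \<Rightarrow> 'a \<Rightarrow> 'b cext) \<Rightarrow> ('a \<Rightarrow> nat \<Rightarrow> 'b cext) \<Rightarrow> bool"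
  where
  "enumerates_minimal C p h u \<longleftrightarrow>
     (\<forall>x. bij_betw (u x) {1..omega C p h x} (minimal_set C (set_map p h x)))"

definition index_set :: "nat \<Rightarrow> (nat \<Rightarrow> 'a \<Rightarrow> 'b cext) \<Rightarrow> 'b cext \<Rightarrow> 'a \<Rightarrow> nat set" where
  "index_set p h w x = {j \<in> {1..p}. h j x = w}"

definition partition_set ::
  "'b::real_normed_vector set \<Rightarrow> nat \<Rightarrow> (nat \<Rightarrow> 'a \<Rightarrow> 'b cext) \<Rightarrow> ('a \<Rightarrow> nat \<Rightarrow> 'b cext)
     \<Rightarrow> 'a \<Rightarrow> (nat \<Rightarrow> nat) set" where
  "partition_set C p h u x = (\<Pi>\<^sub>E j\<in>{1..omega C p h x}. index_set p h (u x j) x)"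

definition stationary ::
  "'b::real_inner set \<Rightarrow> nat \<Rightarrow> (nat \<Rightarrow> 'a::real_vector \<Rightarrow> 'b cext) \<Rightarrow> ('a \<Rightarrow> nat \<Rightarrow> 'b cext)
     \<Rightarrow> 'a \<Rightarrow> bool" where
  "stationary C p h u y \<longleftrightarrow> y \<in> domain_of C p h \<and>
     (\<forall>a\<in>partition_set C p h u y. \<forall>v. \<exists>j\<in>{1..omega C p h y}.
        \<not> dir_deriv_in_neg_int C (h (a j)) y v)"

definition prox_objective ::
  "(real^'m) set \<Rightarrow> nat \<Rightarrow> (nat \<Rightarrow> real^'n \<Rightarrow> real^'m) \<Rightarrow> (nat \<Rightarrow> real^'n \<Rightarrow> (real^'m) cext)
     \<Rightarrow> (nat \<Rightarrow> real^'n \<Rightarrow> (real^'m) cext) \<Rightarrow> real \<Rightarrow> real^'n \<Rightarrow> (nat \<Rightarrow> nat) \<times> (real^'n) \<Rightarrow> ereal"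
  where
  "prox_objective C p f g h l x = (\<lambda>(a, v).
     (MAX j\<in>{1..omega C p h x}.
        phi C (ext_diff (ext_add (Fin (transpose (grad (f (a j)) x) *v v)) (g (a j) (x + v)))
                        (g (a j) x)))
     + ereal (l / 2 * (norm v)\<^sup>2))"

definition prox_grad_run ::
  "(real^'m) set \<Rightarrow> nat \<Rightarrow> (nat \<Rightarrow> real^'n \<Rightarrow> real^'m) \<Rightarrow> (nat \<Rightarrow> real^'n \<Rightarrow> (real^'m) cext)
     \<Rightarrow> (nat \<Rightarrow> real^'n \<Rightarrow> (real^'m) cext) \<Rightarrow> (real^'n \<Rightarrow> nat \<Rightarrow> (real^'m) cext) \<Rightarrow> real
     \<Rightarrow> (nat \<Rightarrow> real^'n) \<Rightarrow> (nat \<Rightarrow> nat \<Rightarrow> nat) \<Rightarrow> (nat \<Rightarrow> real^'n) \<Rightarrow> bool" where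
  "prox_grad_run C p f g h u l x a v \<longleftrightarrow>
     (\<forall>k. is_arg_min (prox_objective C p f g h l (x k))
            (\<lambda>(b, w). b \<in> partition_set C p h u (x k)) (a k, v k)
          \<and> x (Suc k) = x k + v k)"

end

theory Submission
  imports Defs
begin

text \<open>Convexity of \<open>g\<close> along the segment from \<open>x\<^sup>k\<close> to \<open>x\<^sup>k + v\<^sup>k\<close> and optimality of \<open>v\<^sup>k\<close> force
  the max-term of the subproblem to be at most \<open>-l \<parallel>v\<^sup>k\<parallel>\<^sup>2\<close>. With the descent lemma for \<open>f\<close>, every
  minimal element of \<open>H(x\<^sup>k)\<close> is improved, in each direction \<open>z\<close> of the dual unit sphere, by at
  least \<open>(l - L/2) \<parallel>v\<^sup>k\<parallel>\<^sup>2\<close> by some element of \<open>H(x\<^sup>k\<^sup>+\<^sup>1)\<close>. Hence the sets \<open>H(x\<^sup>k)\<close> form a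
  decreasing chain, which is bounded below by assumption, and for a single fixed \<open>z\<close> the numbers
  \<open>min\<^sub>j z\<^sup>T h\<^sup>j(x\<^sup>k)\<close> are bounded below and decrease by at least \<open>(l - L/2) \<parallel>v\<^sup>k\<parallel>\<^sup>2\<close> at each step.\<close>

section \<open>Dual separation and the order of the cone\<close>

text \<open>A strictly separating functional must be nonnegative on a cone, and normalising it keeps
  the signs. Read contrapositively, this tests membership in \<open>C\<close> by unit dual vectors;
  it also shows that such vectors exist.\<close>

lemma closed_convex_cone_separation:
  fixes C :: "'a::euclidean_space set"
  assumes C: "closed C" "convex C" "cone C" "0 \<in> C" and w: "w \<notin> C"
  obtains z where "z \<in> dual_cone C" "norm z = 1" "z \<bullet> w < 0"
proof -
  obtain a b where ab: "a \<bullet> w < b" "\<And>y. y \<in> C \<Longrightarrow> a \<bullet> y > b"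
    using separating_hyperplane_closed_point[OF C(2,1) w] by blast
  have b: "b < 0" using ab(2)[OF C(4)] by simp
  have pos: "a \<bullet> y \<ge> 0" if y: "y \<in> C" for y
  proof (rule ccontr)
    assume neg: "\<not> a \<bullet> y \<ge> 0"
    \<comment> \<open>The factor is positive and chosen so that the scaled point has inner product
      exactly \<open>b\<close> with \<open>a\<close>, against the strict bound on
      \<open>C\<close>.\<close>
    have "(b / (a \<bullet> y)) *\<^sub>R y \<in> C"
      using C(3) y b neg by (auto simp: cone_def divide_nonpos_neg)
    from ab(2)[OF this] show False using neg by simp
  qed
  have aw: "a \<bullet> w < 0" using ab(1) b by linarith
  then have a: "a \<noteq> 0" by auto
  show thesis
  proof (rule that[of "sgn a"])
    show "sgn a \<in> dual_cone C"
      using pos by (auto simp: dual_cone_def sgn_div_norm inner_commute)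
    show "norm (sgn a) = 1" using a by (simp add: norm_sgn)
    show "sgn a \<bullet> w < 0"
      using aw a by (simp add: sgn_div_norm mult_pos_neg divide_neg_pos)
  qed
qed

lemma dual_cone_inner_nonneg: "z \<in> dual_cone C \<Longrightarrow> w \<in> C \<Longrightarrow> 0 \<le> z \<bullet> w"
  by (auto simp: dual_cone_def inner_commute)

lemma convex_cone_add:
  assumes "convex C" "cone C" "y \<in> C" "w \<in> C"
  shows "y + w \<in> C"
  using assms by (metis convex_cone)

lemma cone_le_trans:
  assumes C: "convex C" "cone C" and le: "cone_le C u v" "cone_le C v w"
  shows "cone_le C u w"
proof (cases u; cases v; cases w)
  fix u' v' w' assume eq: "u = Fin u'" "v = Fin v'" "w = Fin w'"
  have "(v' - u') + (w' - v') \<in> C"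
    using le eq by (intro convex_cone_add[OF C]) auto
  then show ?thesis using eq by simp
qed (use le in auto)

lemma pointed_zero: "pointed C \<Longrightarrow> 0 \<in> C"
  by (auto simp: pointed_def)

lemma cone_le_antisym:
  assumes C: "pointed C" and le: "cone_le C u v" "cone_le C v u"
  shows "u = v"
proof (cases u; cases v)
  fix u' v' assume eq: "u = Fin u'" "v = Fin v'"
  have "v' - u' \<in> C" "u' - v' \<in> C" using le eq by auto
  then have "v' - u' \<in> C \<inter> uminus ` C" by (auto simp: image_iff intro!: bexI[of _ "u' - v'"])
  then have "v' - u' = 0" using C by (simp only: pointed_def) simp
  then show ?thesis using eq by simp
qed (use le in auto)

lemma set_le_trans:
  assumes C: "convex C" "cone C" and "set_le C U V" "set_le C V W"
  shows "set_le C U W"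
  using assms(3,4) cone_le_trans[OF C] unfolding set_le_def by meson

lemma set_le_refl:
  assumes "pointed C"
  shows "set_le C U U"
proof -
  have "cone_le C v v" for v by (cases v) (simp_all add: pointed_zero[OF assms])
  then show ?thesis unfolding set_le_def by blast
qed

lemma minimal_set_dominates:
  assumes C: "convex C" "cone C" "pointed C" and U: "finite U" "w \<in> U"
  obtains m where "m \<in> minimal_set C U" "cone_le C m w"
proof -
  let ?R = "\<lambda>y z. y \<noteq> z \<and> cone_le C y z"
  let ?A = "{y \<in> U. cone_le C y w}"
  have "cone_le C w w" by (cases w) (simp_all add: pointed_zero[OF C(3)])
  then have "finite ?A" "?A \<noteq> {}" using U by auto
  moreover have "asymp_on ?A ?R"
    using cone_le_antisym[OF C(3)] by (auto intro!: asymp_onI)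
  moreover have "transp_on ?A ?R"
    by (intro transp_onI conjI; metis cone_le_antisym[OF C(3)] cone_le_trans[OF C(1,2)])
  ultimately obtain m where m: "m \<in> ?A" "\<forall>y\<in>?A. y \<noteq> m \<longrightarrow> \<not> ?R y m"
    using Finite_Set.bex_min_element[of ?A ?R] by blast
  \<comment> \<open>Anything in \<open>U\<close> below \<open>m\<close> is also below
    \<open>w\<close>, hence in \<open>?A\<close>; so minimality in \<open>?A\<close> is minimality
    in \<open>U\<close>.\<close>
  have "y = m" if "y \<in> U" "cone_le C y m" for y
    using m that cone_le_trans[OF C(1,2) that(2), of w] by blast
  then have "m \<in> minimal_set C U" using m(1) unfolding minimal_set_def by blast
  with m that show thesis by blast
qed

section \<open>Scalarised estimates for \<open>phi\<close>, \<open>g\<close> and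
  \<open>f\<close>\<close>

lemma phi_finite_less_infty: "phi C (Fin w) < \<infinity>"
proof -
  have "phi C (Fin w) \<le> ereal (norm w)"
    using norm_cauchy_schwarz[of _ w] by (auto intro!: SUP_least) (metis mult_1)
  then show ?thesis by (rule order_le_less_trans) simp
qed

text \<open>Carries an inequality that holds in every dual direction over to \<open>phi\<close>;
  convexity of \<open>g\<close> enters the subproblem in this form.\<close>

lemma phi_scale_le:
  assumes t: "0 < t" and le: "\<And>z. z \<in> dual_cone C \<Longrightarrow> z \<bullet> w \<le> t * (z \<bullet> y)"
  shows "phi C (Fin w) \<le> ereal t * phi C (Fin y)"
proof (simp only: phi.simps, rule SUP_least)
  fix z assume z: "z \<in> {z \<in> dual_cone C. norm z = 1}"
  have "ereal (z \<bullet> w) \<le> ereal t * ereal (z \<bullet> y)" using le z by simp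
  also have "\<dots> \<le> ereal t * (SUP z\<in>{z \<in> dual_cone C. norm z = 1}. ereal (z \<bullet> y))"
    using t z by (intro ereal_mult_left_mono SUP_upper) auto
  finally show "ereal (z \<bullet> w) \<le> \<dots>" .
qed

text \<open>Finite values at both ends make the upper bound in the convexity inequality finite, and
  only finite elements lie below a finite one.\<close>

lemma cone_convex_segment:
  assumes conv: "cone_convex C g" and fin: "g y = Fin G0" "g (y + v) = Fin G1"
    and t: "0 < t" "t \<le> 1"
  obtains Gt where "g (y + t *\<^sub>R v) = Fin Gt"
    "\<And>z. z \<in> dual_cone C \<Longrightarrow> z \<bullet> (Gt - G0) \<le> t * (z \<bullet> (G1 - G0))"
proof -
  have eq: "t *\<^sub>R (y + v) + (1 - t) *\<^sub>R y = y + t *\<^sub>R v" by (simp add: algebra_simps)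
  have "cone_le C (g (t *\<^sub>R (y + v) + (1 - t) *\<^sub>R y))
          (ext_add (ext_scale t (g (y + v))) (ext_scale (1 - t) (g y)))"
    using conv t unfolding cone_convex_def by simp
  then have le: "cone_le C (g (y + t *\<^sub>R v)) (Fin (t *\<^sub>R G1 + (1 - t) *\<^sub>R G0))"
    by (simp add: eq fin)
  then obtain Gt where Gt: "g (y + t *\<^sub>R v) = Fin Gt" by (cases "g (y + t *\<^sub>R v)") auto
  show thesis
  proof (rule that[OF Gt])
    fix z assume "z \<in> dual_cone C"
    then have "z \<bullet> (t *\<^sub>R G1 + (1 - t) *\<^sub>R G0 - Gt) \<ge> 0"
      using le Gt by (intro dual_cone_inner_nonneg) auto
    then show "z \<bullet> (Gt - G0) \<le> t * (z \<bullet> (G1 - G0))"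
      by (simp add: inner_diff_right inner_add_right algebra_simps)
  qed
qed

text \<open>Along the segment, \<open>\<psi>\<close> is \<open>z \<bullet> f\<close> minus its
  linear part and the quadratic allowance. The Lipschitz bound makes its derivative nonpositive, so
  comparing \<open>\<psi> 1\<close> with \<open>\<psi> 0\<close> suffices.\<close>

lemma descent_lemma:
  fixes f :: "real^'n \<Rightarrow> real^'m"
  assumes f: "cont_diff f" "lipschitz_grad K f" and z: "norm z = 1"
  shows "z \<bullet> f (y + v) \<le> z \<bullet> f y + z \<bullet> (transpose (grad f y) *v v) + K / 2 * (norm v)\<^sup>2"
proof -
  define d where "d y = transpose (grad f y) *v v" for y
  define \<psi> where "\<psi> t = z \<bullet> f (y + t *\<^sub>R v) - t * (z \<bullet> d y) - K / 2 * t\<^sup>2 * (norm v)\<^sup>2" for t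
  have deriv: "(\<psi> has_real_derivative (z \<bullet> d (y + t *\<^sub>R v) - z \<bullet> d y - K * t * (norm v)\<^sup>2)) (at t)" for t
  proof -
    have "(f has_derivative (\<lambda>w. transpose (grad f (y + t *\<^sub>R v)) *v w)) (at (y + t *\<^sub>R v))"
      using f(1) jacobian_works[of f "at (y + t *\<^sub>R v)"] by (simp add: cont_diff_def grad_def)
    then have "((\<lambda>s. f (y + s *\<^sub>R v)) has_derivative (\<lambda>s. transpose (grad f (y + t *\<^sub>R v)) *v (s *\<^sub>R v))) (at t)"
      by (rule has_derivative_compose[rotated]) (auto intro!: derivative_eq_intros)
    then have "((\<lambda>s. z \<bullet> f (y + s *\<^sub>R v)) has_derivative (\<lambda>s. z \<bullet> (s *\<^sub>R d (y + t *\<^sub>R v)))) (at t)"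
      unfolding d_def by (intro has_derivative_inner_right) (simp add: matrix_vector_mult_scaleR)
    then have "((\<lambda>s. z \<bullet> f (y + s *\<^sub>R v)) has_real_derivative (z \<bullet> d (y + t *\<^sub>R v))) (at t)"
      by (simp add: has_field_derivative_def mult.commute[of _ "z \<bullet> _"] mult_commute_abs)
    then show ?thesis unfolding \<psi>_def by (auto intro!: derivative_eq_intros)
  qed
  have "z \<bullet> d (y + t *\<^sub>R v) - z \<bullet> d y - K * t * (norm v)\<^sup>2 \<le> 0" if t: "0 \<le> t" for t
  proof -
    let ?M = "grad f (y + t *\<^sub>R v) - grad f y"
    have "norm (?M *v z) \<le> onorm (\<lambda>w. ?M *v w) * norm z"
      by (intro onorm matrix_vector_mul_bounded_linear)
    also have "\<dots> \<le> K * norm (y + t *\<^sub>R v - y)"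
      using f(2)[unfolded lipschitz_grad_def, rule_format, of "y + t *\<^sub>R v" y] z by simp
    finally have M: "norm (?M *v z) \<le> K * t * norm v" using t by simp
    \<comment> \<open>Moving the transpose onto the unit vector \<open>z\<close> lets the operator
      norm bound on gradient differences apply.\<close>
    have "z \<bullet> d y' = (grad f y' *v z) \<bullet> v" for y'
      unfolding d_def by (metis dot_lmul_matrix vector_transpose_matrix)
    then have "z \<bullet> d (y + t *\<^sub>R v) - z \<bullet> d y = (?M *v z) \<bullet> v"
      by (simp add: matrix_vector_mult_diff_rdistrib inner_diff_left)
    also have "\<dots> \<le> norm (?M *v z) * norm v" by (rule norm_cauchy_schwarz)
    also have "\<dots> \<le> K * t * norm v * norm v" using M by (intro mult_right_mono) auto
    finally show ?thesis by (simp add: power2_eq_square mult.assoc)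
  qed
  then have "\<psi> 1 \<le> \<psi> 0"
    using deriv by (intro DERIV_nonpos_imp_nonincreasing[of 0 1 \<psi>]) (simp, blast)
  then show ?thesis by (simp add: \<psi>_def d_def)
qed

section \<open>Decrease in one step of the method\<close>

lemma subproblem_max_le:
  assumes conv: "\<And>j. j \<in> {1..p} \<Longrightarrow> cone_convex C (g j)"
    and fin: "\<And>j. j \<in> {1..p} \<Longrightarrow> g j y = Fin (G0 j)" "\<And>j. j \<in> {1..p} \<Longrightarrow> g j (y + v) = Fin (G1 j)"
    and min: "is_arg_min (prox_objective C p f g h l y)
                (\<lambda>(b, w). b \<in> partition_set C p h u y) (b, v)"
    and i: "i \<in> {1..omega C p h y}"
  shows "phi C (Fin (transpose (grad (f (b i)) y) *v v + G1 (b i) - G0 (b i)))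
           \<le> ereal (- l * (norm v)\<^sup>2)"
proof -
  let ?I = "{1..omega C p h y}"
  let ?q = "\<lambda>w j. phi C (ext_diff (ext_add (Fin (transpose (grad (f (b j)) y) *v w)) (g (b j) (y + w)))
                        (g (b j) y))"
  let ?V = "(norm v)\<^sup>2"
  define Q where "Q w = (MAX j\<in>?I. ?q w j)" for w
  have b: "b j \<in> {1..p}" if "j \<in> ?I" for j
    using min that unfolding is_arg_min_def partition_set_def index_set_def
    by (auto dest: PiE_mem)
  have I: "finite ?I" "?I \<noteq> {}" using i by auto
  have qv: "?q v j = phi C (Fin (transpose (grad (f (b j)) y) *v v + G1 (b j) - G0 (b j)))"
    if "j \<in> ?I" for j
    using fin b[OF that] by simp
  have "Q v \<in> ?q v ` ?I" unfolding Q_def using I by (intro Max_in) auto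
  then have Qv: "Q v < \<infinity>" using qv phi_finite_less_infty by force
  have le_Qv: "phi C (Fin (transpose (grad (f (b j)) y) *v v + G1 (b j) - G0 (b j))) \<le> Q v"
    if "j \<in> ?I" for j
    unfolding qv[OF that, symmetric] Q_def using I that by (intro Max_ge finite_imageI imageI)
  \<comment> \<open>The competitor is \<open>(b, t *\<^sub>R v)\<close> with the same index tuple
    \<open>b\<close>; it is feasible because the constraint leaves the direction free.\<close>
  have opt: "Q v + ereal (l / 2 * ?V) \<le> ereal t * Q v + ereal (l / 2 * (t\<^sup>2 * ?V))"
    if t: "0 < t" "t < 1" for t
  proof -
    have "?q (t *\<^sub>R v) j \<le> ereal t * Q v" if j: "j \<in> ?I" for j
    proof -
      obtain Gt where Gt: "g (b j) (y + t *\<^sub>R v) = Fin Gt"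
        "\<And>z. z \<in> dual_cone C \<Longrightarrow> z \<bullet> (Gt - G0 (b j)) \<le> t * (z \<bullet> (G1 (b j) - G0 (b j)))"
        using cone_convex_segment[OF conv[OF b[OF j]] fin(1)[OF b[OF j]] fin(2)[OF b[OF j]] t(1)] t(2)
        by (metis less_imp_le)
      have "?q (t *\<^sub>R v) j = phi C (Fin (transpose (grad (f (b j)) y) *v (t *\<^sub>R v) + Gt - G0 (b j)))"
        using fin b[OF j] Gt by simp
      also have "\<dots> \<le> ereal t * phi C (Fin (transpose (grad (f (b j)) y) *v v + G1 (b j) - G0 (b j)))"
        using Gt(2) by (intro phi_scale_le[OF t(1)])
          (simp add: matrix_vector_mult_scaleR inner_add_right inner_diff_right algebra_simps)
      also have "\<dots> \<le> ereal t * Q v"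
        using t by (intro ereal_mult_left_mono le_Qv[OF j]) auto
      finally show ?thesis .
    qed
    then have "Q (t *\<^sub>R v) \<le> ereal t * Q v" unfolding Q_def using I by (subst Max_le_iff) auto
    moreover have "prox_objective C p f g h l y (b, v) \<le> prox_objective C p f g h l y (b, t *\<^sub>R v)"
      using min unfolding is_arg_min_def by (auto simp: not_less)
    then have "Q v + ereal (l / 2 * ?V) \<le> Q (t *\<^sub>R v) + ereal (l / 2 * (t\<^sup>2 * ?V))"
      using t by (simp add: prox_objective_def Q_def power_mult_distrib)
    ultimately show ?thesis by (meson add_right_mono order_trans)
  qed
  have "Q v \<le> ereal (- l * ?V)"
  \<comment> \<open>The value \<infinity> is excluded by \<open>Qv\<close>, and for -\<infinity> the
    claim is immediate.\<close>
  proof (cases "Q v")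
    case (real r)
    \<comment> \<open>Dividing \<open>1 - t\<^sup>2\<close> by \<open>1 - t\<close> leaves
      \<open>1 + t\<close>; letting \<open>t\<close> tend to 1 doubles \<open>l / 2\<close> to
      \<open>l\<close>.\<close>
    have "r \<le> - l / 2 * (1 + t) * ?V" if t: "0 < t" "t < 1" for t
    proof -
      have "r + l / 2 * ?V \<le> t * r + l / 2 * (t\<^sup>2 * ?V)" using opt[OF t] real by simp
      then have "(1 - t) * r \<le> (1 - t) * (- l / 2 * (1 + t) * ?V)"
        by (simp add: field_simps power2_eq_square)
      then show ?thesis using t(2) by (simp only: mult_le_cancel_left_pos diff_gt_0_iff_gt)
    qed
    then have "\<forall>\<^sub>F t in at_left 1. r \<le> - l / 2 * (1 + t) * ?V"
      using eventually_at_left_real[of 0 1] by (auto elim: eventually_mono)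
    moreover have "((\<lambda>t. - l / 2 * (1 + t) * ?V) \<longlongrightarrow> - l / 2 * (1 + 1) * ?V) (at_left 1)"
      by (intro tendsto_intros)
    ultimately have "r \<le> - l / 2 * (1 + 1) * ?V"
      by (intro tendsto_lowerbound) (auto simp: trivial_limit_at_left_real)
    then show ?thesis using real by simp
  qed (use Qv in auto)
  with le_Qv[OF i] show ?thesis by (rule order_trans)
qed

text \<open>The subproblem controls only indices representing minimal elements, so \<open>i\<close>
  is first replaced by an index \<open>b s\<close> whose value is minimal and below
  \<open>h i y\<close>. The index \<open>j\<close> is fixed before \<open>z\<close>, as comparison
  in the cone order requires.\<close>

lemma prox_step_decrease:
  assumes C: "convex C" "cone C" "pointed C"
    and h: "\<And>j y. j \<in> {1..p} \<Longrightarrow> h j y = ext_add (Fin (f j y)) (g j y)"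
    and f: "\<And>j. j \<in> {1..p} \<Longrightarrow> cont_diff (f j)" "\<And>j. j \<in> {1..p} \<Longrightarrow> lipschitz_grad (Lip j) (f j)"
    and conv: "\<And>j. j \<in> {1..p} \<Longrightarrow> cone_convex C (g j)"
    and u: "enumerates_minimal C p h u"
    and L: "L = Max (Lip ` {1..p})"
    and fin: "\<And>j. j \<in> {1..p} \<Longrightarrow> h j y = Fin (H0 j)" "\<And>j. j \<in> {1..p} \<Longrightarrow> h j (y + v) = Fin (H1 j)"
    and min: "is_arg_min (prox_objective C p f g h l y)
                (\<lambda>(b, w). b \<in> partition_set C p h u y) (b, v)"
    and i: "i \<in> {1..p}"
  obtains j where "j \<in> {1..p}"
    "\<And>z. z \<in> dual_cone C \<Longrightarrow> norm z = 1 \<Longrightarrow> z \<bullet> H1 j \<le> z \<bullet> H0 i - (l - L / 2) * (norm v)\<^sup>2"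
proof -
  have gfin: "g j y = Fin (H0 j - f j y)" "g j (y + v) = Fin (H1 j - f j (y + v))"
    if "j \<in> {1..p}" for j
    using h[OF that, of y] h[OF that, of "y + v"] fin[OF that]
    by (cases "g j y"; cases "g j (y + v)"; auto)+
  have "finite (set_map p h y)" "h i y \<in> set_map p h y"
    using i by (auto simp: set_map_def)
  then obtain m where m: "m \<in> minimal_set C (set_map p h y)" "cone_le C m (h i y)"
    using minimal_set_dominates[OF C] by blast
  then have "m \<in> u y ` {1..omega C p h y}"
    using u by (simp add: enumerates_minimal_def bij_betw_def)
  then obtain s where s: "s \<in> {1..omega C p h y}" "u y s = m" by blast
  have "b s \<in> index_set p h (u y s) y"
    using min s(1) unfolding is_arg_min_def partition_set_def by (auto dest: PiE_mem)
  then have bs: "b s \<in> {1..p}" "h (b s) y = m" using s by (auto simp: index_set_def)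
  have le: "H0 i - H0 (b s) \<in> C" using m(2) bs fin i by auto
  show thesis
  proof (rule that[OF bs(1)])
    fix z assume z: "z \<in> dual_cone C" "norm z = 1"
    let ?D = "transpose (grad (f (b s)) y) *v v" and ?V = "(norm v)\<^sup>2"
    have "ereal (z \<bullet> (?D + (H1 (b s) - f (b s) (y + v)) - (H0 (b s) - f (b s) y)))
        \<le> phi C (Fin (?D + (H1 (b s) - f (b s) (y + v)) - (H0 (b s) - f (b s) y)))"
      using z by (auto intro!: SUP_upper2[of z])
    also have "\<dots> \<le> ereal (- l * ?V)"
      by (rule subproblem_max_le[OF conv gfin min s(1)])
    finally have "z \<bullet> ?D + z \<bullet> H1 (b s) - z \<bullet> f (b s) (y + v) - z \<bullet> H0 (b s) + z \<bullet> f (b s) y \<le> - l * ?V"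
      by (simp add: inner_add_right inner_diff_right)
    moreover have "z \<bullet> f (b s) (y + v) \<le> z \<bullet> f (b s) y + z \<bullet> ?D + Lip (b s) / 2 * ?V"
      by (rule descent_lemma[OF f(1)[OF bs(1)] f(2)[OF bs(1)] z(2)])
    moreover have "Lip (b s) \<le> L" unfolding L using bs(1) by (intro Max_ge) auto
    then have "Lip (b s) / 2 * ?V \<le> L / 2 * ?V" by (intro mult_right_mono) auto
    moreover have "z \<bullet> H0 (b s) \<le> z \<bullet> H0 i"
      using dual_cone_inner_nonneg[OF z(1) le] by (simp add: inner_diff_right)
    ultimately show "z \<bullet> H1 (b s) \<le> z \<bullet> H0 i - (l - L / 2) * ?V"
      by (simp add: algebra_simps)
  qed
qed

section \<open>Convergence of the steps\<close>

text \<open>Telescoping bounds the partial sums by \<open>m 0 - B\<close>, so \<open>d\<close> is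
  summable.\<close>

lemma tendsto_zero_if_decrease:
  fixes m d :: "nat \<Rightarrow> real"
  assumes dec: "\<And>k. m (Suc k) \<le> m k - d k" and d: "\<And>k. d k \<ge> 0" and bd: "\<And>k. m k \<ge> B"
  shows "d \<longlonglongrightarrow> 0"
proof -
  have "(\<Sum>k<n. d k) \<le> m 0 - m n" for n
  proof (induction n)
    case (Suc n)
    then show ?case using dec[of n] by simp
  qed simp
  from this[of "Suc _"] have "(\<Sum>k\<le>n. d k) \<le> m 0 - B" for n
    using bd[of "Suc n"] unfolding lessThan_Suc_atMost by (smt (verit))
  then have "summable d" using d by (intro bounded_imp_summable[of _ "m 0 - B"]) auto
  then show ?thesis by (rule summable_LIMSEQ_zero)
qed

theorem theorem5p2:
  fixes C :: "(real^'m) set" and p :: nat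
    and f :: "nat \<Rightarrow> real^'n \<Rightarrow> real^'m"
    and g h :: "nat \<Rightarrow> real^'n \<Rightarrow> (real^'m) cext"
    and u :: "real^'n \<Rightarrow> nat \<Rightarrow> (real^'m) cext"
    and x0 :: "real^'n" and Lip :: "nat \<Rightarrow> real" and L l :: real
    and x v :: "nat \<Rightarrow> real^'n" and a :: "nat \<Rightarrow> nat \<Rightarrow> nat"
  assumes "closed C" "convex C" "cone C" "pointed C" "interior C \<noteq> {}"
    and "p \<ge> 1"
    and "\<And>j y. j \<in> {1..p} \<Longrightarrow> h j y = ext_add (Fin (f j y)) (g j y)"
    and "\<And>j. j \<in> {1..p} \<Longrightarrow> cont_diff (f j)"
    and "\<And>j. j \<in> {1..p} \<Longrightarrow> proper_fun (g j) \<and> closed_fun C (g j) \<and> cone_convex C (g j)"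
    and "enumerates_minimal C p h u"
    and "x0 \<in> domain_of C p h"
    and "chains_bounded C p h x0"
    and "\<And>j. j \<in> {1..p} \<Longrightarrow> lipschitz_grad (Lip j) (f j)"
    and "L = Max (Lip ` {1..p})"
    and "l > L / 2" "l > 0"
    and "x 0 = x0"
    and "\<And>k. x k \<in> domain_of C p h \<and> \<not> stationary C p h u (x k)"
    and "prox_grad_run C p f g h u l x a v"
  shows "(\<lambda>k. norm (v k)) \<longlonglongrightarrow> 0"
proof -
  note C = assms(1-4) and p = assms(6)
  have C0: "0 \<in> C" using C(4) by (rule pointed_zero)
  have ex: "\<exists>w. h j (x k) = Fin w" if "j \<in> {1..p}" for j k
  proof -
    have "cone_less C (h j (x k)) PInf" using assms(18)[of k] that unfolding domain_of_def by blast
    then show ?thesis by (cases "h j (x k)") auto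
  qed
  \<comment> \<open>The finite values of \<open>h\<close> along the run, meaningful for
    \<open>j\<close> in \<open>{1..p}\<close>.\<close>
  define \<eta> where "\<eta> k j = (SOME w. h j (x k) = Fin w)" for k j
  have \<eta>: "h j (x k) = Fin (\<eta> k j)" if "j \<in> {1..p}" for j k
    unfolding \<eta>_def by (rule someI_ex[OF ex[OF that]])
  have run: "is_arg_min (prox_objective C p f g h l (x k))
      (\<lambda>(b, w). b \<in> partition_set C p h u (x k)) (a k, v k)" "x (Suc k) = x k + v k" for k
    using assms(19) unfolding prox_grad_run_def by auto
  have step: "\<exists>j\<in>{1..p}. \<forall>z. z \<in> dual_cone C \<longrightarrow> norm z = 1 \<longrightarrow>
      z \<bullet> \<eta> (Suc k) j \<le> z \<bullet> \<eta> k i - (l - L / 2) * (norm (v k))\<^sup>2" if i: "i \<in> {1..p}" for i k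
  proof -
    have fin: "h j (x k + v k) = Fin (\<eta> (Suc k) j)" if "j \<in> {1..p}" for j
      using \<eta>[OF that, of "Suc k"] run(2)[of k] by simp
    have conv: "cone_convex C (g j)" if "j \<in> {1..p}" for j using assms(9)[OF that] by blast
    from prox_step_decrease[OF C(2-4) assms(7,8,13) conv assms(10,14) \<eta> fin run(1) i]
    show ?thesis by blast
  qed
  have c: "l - L / 2 > 0" using assms(15) by simp
  have H: "set_map p h (x k) = (\<lambda>j. Fin (\<eta> k j)) ` {1..p}" for k
    unfolding set_map_def Setcompr_eq_image by (intro image_cong refl) (simp only: \<eta> Collect_mem_eq)
  have chain: "set_le C (set_map p h (x (Suc k))) (set_map p h (x k))" for k
  proof -
    have "\<exists>j\<in>{1..p}. \<eta> k i - \<eta> (Suc k) j \<in> C" if i: "i \<in> {1..p}" for i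
    proof -
      obtain j where j: "j \<in> {1..p}" "\<And>z. z \<in> dual_cone C \<Longrightarrow> norm z = 1 \<Longrightarrow>
          z \<bullet> \<eta> (Suc k) j \<le> z \<bullet> \<eta> k i - (l - L / 2) * (norm (v k))\<^sup>2"
        using step[OF i] by blast
      \<comment> \<open>Otherwise some unit dual vector would be negative on the difference,
        although \<open>j\<close> gives a nonnegative decrease in every such direction.\<close>
      have "\<eta> k i - \<eta> (Suc k) j \<in> C"
      proof (rule ccontr)
        assume "\<eta> k i - \<eta> (Suc k) j \<notin> C"
        then obtain z where z: "z \<in> dual_cone C" "norm z = 1" "z \<bullet> (\<eta> k i - \<eta> (Suc k) j) < 0"
          using closed_convex_cone_separation[OF C(1-3) C0] by blast
        have "(l - L / 2) * (norm (v k))\<^sup>2 \<ge> 0" using c by simp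
        with j(2)[OF z(1,2)] z(3) show False by (simp add: inner_diff_right)
      qed
      with j(1) show ?thesis by blast
    qed
    then show ?thesis unfolding H set_le_def by auto
  qed
  have "x k \<in> level_set C p h x0" for k
  proof (induction k)
    case 0
    show ?case using set_le_refl[OF C(4)] assms(17) by (simp add: level_set_def)
  next
    case (Suc k)
    then show ?case using set_le_trans[OF C(2,3) chain[of k]] by (simp add: level_set_def)
  qed
  then obtain B where B: "bounded B" "\<And>k. set_le C (Fin ` B) (set_map p h (x k))"
    using assms(12)[unfolded chains_bounded_def, rule_format, of "\<lambda>k. set_map p h (x k)"] chain
    by blast
  obtain R where R: "\<And>y. y \<in> B \<Longrightarrow> norm y \<le> R" using B(1) by (auto simp: bounded_iff)
  \<comment> \<open>A pointed cone misses one of two opposite nonzero vectors, and separating that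
    one yields a unit dual vector. The coordinate \<open>undefined\<close> is an arbitrary
    index.\<close>
  have "axis undefined 1 \<notin> C \<or> - axis undefined 1 \<notin> C"
  proof (rule ccontr)
    assume "\<not> ?thesis"
    then have "axis undefined (1::real) \<in> C \<inter> uminus ` C"
      by (auto simp: image_iff intro!: bexI[of _ "- axis undefined 1"])
    then have "axis undefined (1::real) = (0 :: real^'m)" using C(4) by (simp only: pointed_def) simp
    then show False by (simp add: axis_eq_0_iff)
  qed
  then obtain z where z: "z \<in> dual_cone C" "norm z = 1"
    using closed_convex_cone_separation[OF C(1-3) C0] by metis
  \<comment> \<open>The minimum over all indices absorbs the change of index from \<open>i\<close>
    to \<open>j\<close> in each step.\<close>
  define m where "m k = Min ((\<lambda>j. z \<bullet> \<eta> k j) ` {1..p})" for k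
  have ne: "{1..p} \<noteq> {}" using p by simp
  have m_in: "\<exists>i\<in>{1..p}. m k = z \<bullet> \<eta> k i" for k
  proof -
    have "m k \<in> (\<lambda>j. z \<bullet> \<eta> k j) ` {1..p}" unfolding m_def using ne by (intro Min_in) auto
    then show ?thesis by blast
  qed
  have "(\<lambda>k. (l - L / 2) * (norm (v k))\<^sup>2) \<longlonglongrightarrow> 0"
  proof (rule tendsto_zero_if_decrease[of m _ "- R"])
    fix k
    obtain i where i: "i \<in> {1..p}" "m k = z \<bullet> \<eta> k i" using m_in by blast
    obtain j where j: "j \<in> {1..p}" "z \<bullet> \<eta> (Suc k) j \<le> z \<bullet> \<eta> k i - (l - L / 2) * (norm (v k))\<^sup>2"
      using step[OF i(1)] z by blast
    have "m (Suc k) \<le> z \<bullet> \<eta> (Suc k) j" unfolding m_def using j(1) by (intro Min_le) auto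
    then show "m (Suc k) \<le> m k - (l - L / 2) * (norm (v k))\<^sup>2" using i(2) j(2) by simp
    show "(l - L / 2) * (norm (v k))\<^sup>2 \<ge> 0" using c by simp
    \<comment> \<open>Some point of the bounded set lies below the value attaining
      \<open>m k\<close>; \<open>z\<close> preserves this order, and Cauchy-Schwarz gives the bound
      \<open>- R\<close>.\<close>
    obtain y where y: "y \<in> B" "\<eta> k i - y \<in> C"
      using B(2)[of k] i(1) unfolding H set_le_def by fastforce
    have "- R \<le> z \<bullet> y" using Cauchy_Schwarz_ineq2[of z y] R[OF y(1)] z(2) by simp
    also have "\<dots> \<le> m k" using dual_cone_inner_nonneg[OF z(1) y(2)] i(2)
      by (simp add: inner_diff_right)
    finally show "m k \<ge> - R" .
  qed
  from tendsto_mult_left[OF this, of "1 / (l - L / 2)"] c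
  have "(\<lambda>k. (norm (v k))\<^sup>2) \<longlonglongrightarrow> 0" by simp
  from tendsto_real_sqrt[OF this] show ?thesis by simp
qed

end
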